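(* Let $S$ be a multiplicative subset of a commutative ring $R$ with nonzero identity. Let $M_1$ and $M_2$ be $R$-modules and let $K_1\leq M_1$ and $K_2\leq M_2$ be submodules. Then $K_1\oplus K_2$ is $u$-$S$-essential in $M_1\oplus M_2$ if and only if $K_1$ is $u$-$S$-essential in $M_1$ and $K_2$ is $u$-$S$-essential in $M_2$.
   Context: A multiplicative subset $S$ of $R$ satisfies $1\in S$, $0\notin S$, and $s_1s_2\in S$ for all $s_1,s_2\in S$. All modules are unitary. An $R$-module $X$ is $u$-$S$-torsion if there exists $s\in S$ with $sX=0$. A submodule $N$ of $M$ is $u$-$S$-essential in $M$ if for every submodule $L$ of $M$, $N\cap L$ being $u$-$S$-torsion implies that $L$ is $u$-$S$-torsion. *)

theory Defs
  imports "HOL-Algebra.Module"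
begin

definition multiplicative_subset :: "('a, 'r) ring_scheme \<Rightarrow> 'a set \<Rightarrow> bool"
  where "multiplicative_subset R S \<longleftrightarrow> submonoid S R \<and> \<zero>\<^bsub>R\<^esub> \<notin> S"

definition u_S_torsion :: "'a set \<Rightarrow> ('a, 'b, 'm) module_scheme \<Rightarrow> bool"
  where "u_S_torsion S X \<longleftrightarrow>
    (\<exists>s\<in>S. (\<lambda>x. s \<odot>\<^bsub>X\<^esub> x) ` carrier X = {\<zero>\<^bsub>X\<^esub>})"

definition u_S_essential ::
  "('a, 'r) ring_scheme \<Rightarrow> 'a set \<Rightarrow> 'b set \<Rightarrow> ('a, 'b, 'm) module_scheme \<Rightarrow> bool"
  where "u_S_essential R S N M \<longleftrightarrow>
    submodule N R M \<and>
    (\<forall>L. submodule L R M \<longrightarrow>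
       u_S_torsion S (M\<lparr>carrier := N \<inter> L\<rparr>) \<longrightarrow> u_S_torsion S (M\<lparr>carrier := L\<rparr>))"

text \<open>
  External direct sum of two modules, with componentwise operations. The fields mult and one
  are inherited from the ring record and play no role in the module locale, so their values
  are arbitrary. For subsets \<open>K\<^sub>1\<close> and \<open>K\<^sub>2\<close> of the carriers of \<open>M\<^sub>1\<close> and \<open>M\<^sub>2\<close>, the sum
  \<open>K\<^sub>1 \<oplus> K\<^sub>2\<close> is the subset \<open>K\<^sub>1 \<times> K\<^sub>2\<close> of the carrier.
\<close>
definition direct_sum ::
  "('a, 'b, 'm) module_scheme \<Rightarrow> ('a, 'c, 'n) module_scheme \<Rightarrow> ('a, 'b \<times> 'c) module"
  where "direct_sum M1 M2 =
    \<lparr>carrier = carrier M1 \<times> carrier M2,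
     mult = (\<lambda>_ _. (\<zero>\<^bsub>M1\<^esub>, \<zero>\<^bsub>M2\<^esub>)),
     one = (\<zero>\<^bsub>M1\<^esub>, \<zero>\<^bsub>M2\<^esub>),
     zero = (\<zero>\<^bsub>M1\<^esub>, \<zero>\<^bsub>M2\<^esub>),
     add = (\<lambda>(x1, x2) (y1, y2). (x1 \<oplus>\<^bsub>M1\<^esub> y1, x2 \<oplus>\<^bsub>M2\<^esub> y2)),
     smult = (\<lambda>a (x1, x2). (a \<odot>\<^bsub>M1\<^esub> x1, a \<odot>\<^bsub>M2\<^esub> x2))\<rparr>"

lemma direct_sum_module:
  assumes "module R M1" and "module R M2"
  shows "module R (direct_sum M1 M2)"
proof -
  interpret M1: module R M1 by fact
  interpret M2: module R M2 by fact
  have inv: "\<exists>y\<in>carrier (direct_sum M1 M2). y \<oplus>\<^bsub>direct_sum M1 M2\<^esub> x = \<zero>\<^bsub>direct_sum M1 M2\<^esub>"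
    if "x \<in> carrier (direct_sum M1 M2)" for x
    using that
    by (intro bexI[where x = "(\<ominus>\<^bsub>M1\<^esub> fst x, \<ominus>\<^bsub>M2\<^esub> snd x)"])
      (auto simp: direct_sum_def M1.M.l_neg M2.M.l_neg)
  have "abelian_group (direct_sum M1 M2)"
    by (rule abelian_groupI[OF _ _ _ _ _ inv])
      (auto simp: direct_sum_def M1.M.a_ac M2.M.a_ac)
  then show ?thesis
    by (intro moduleI M1.R.is_cring)
      (auto simp: direct_sum_def M1.smult_l_distr M2.smult_l_distr M1.smult_r_distr
        M2.smult_r_distr M1.smult_assoc1 M2.smult_assoc1)
qed

end

theory Submission
  imports Defs
begin

text \<open>
  The preimage of a \<open>u\<close>-\<open>S\<close>-essential submodule \<open>K\<close> under a homomorphism \<open>f\<close> is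
  \<open>u\<close>-\<open>S\<close>-essential: if \<open>s\<close> annihilates the part of \<open>L\<close> in the preimage, it annihilates
  \<open>K \<inter> f(L)\<close>, so some \<open>t\<close> annihilates \<open>f(L)\<close>; then \<open>tL\<close> lies in the kernel, hence in the
  preimage, and \<open>stL = 0\<close>. Both directions follow, because \<open>K\<^sub>1\<close> and \<open>K\<^sub>2\<close> are the preimages of
  \<open>K\<^sub>1 \<oplus> K\<^sub>2\<close> under the injections, and \<open>K\<^sub>1 \<oplus> K\<^sub>2\<close> is the intersection of the preimages of
  \<open>K\<^sub>1\<close> and \<open>K\<^sub>2\<close> under the projections.
\<close>

locale module_homomorphism =
  dom: module R M + cod: module R N
  for R :: "('a, 'r) ring_scheme"
    and M :: "('a, 'b, 'm) module_scheme"
    and N :: "('a, 'c, 'n) module_scheme"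
    and f :: "'b \<Rightarrow> 'c" +
  assumes hom_closed: "x \<in> carrier M \<Longrightarrow> f x \<in> carrier N"
    and hom_add: "x \<in> carrier M \<Longrightarrow> y \<in> carrier M \<Longrightarrow> f (x \<oplus>\<^bsub>M\<^esub> y) = f x \<oplus>\<^bsub>N\<^esub> f y"
    and hom_smult: "a \<in> carrier R \<Longrightarrow> x \<in> carrier M \<Longrightarrow> f (a \<odot>\<^bsub>M\<^esub> x) = a \<odot>\<^bsub>N\<^esub> f x"

lemma (in module) submodule_zero:
  assumes "submodule H R M"
  shows "\<zero>\<^bsub>M\<^esub> \<in> H"
  using subgroup.one_closed[OF submodule.axioms(1)[OF assms]] by simp

text \<open>Closure under negation follows from closure under scalars, because -x = (-1)x. This
  spares the later submodule proofs any argument about inverses.\<close>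

lemma (in module) submoduleI_smult:
  assumes "H \<subseteq> carrier M" and "\<zero>\<^bsub>M\<^esub> \<in> H"
    and "\<And>x y. x \<in> H \<Longrightarrow> y \<in> H \<Longrightarrow> x \<oplus>\<^bsub>M\<^esub> y \<in> H"
    and smult: "\<And>a x. a \<in> carrier R \<Longrightarrow> x \<in> H \<Longrightarrow> a \<odot>\<^bsub>M\<^esub> x \<in> H"
  shows "submodule H R M"
proof (rule submoduleI)
  fix x assume "x \<in> H"
  with assms(1) have "\<ominus>\<^bsub>M\<^esub> x = (\<ominus> \<one>) \<odot>\<^bsub>M\<^esub> x"
    by (subst smult_l_minus) auto
  with smult[of "\<ominus> \<one>" x] \<open>x \<in> H\<close> show "\<ominus>\<^bsub>M\<^esub> x \<in> H"
    by simp
qed (use assms in auto)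

lemma (in module) submodule_Int:
  assumes "submodule H R M" and "submodule K R M"
  shows "submodule (H \<inter> K) R M"
  using submoduleE[OF assms(1)] submoduleE[OF assms(2)]
    submodule_zero[OF assms(1)] submodule_zero[OF assms(2)]
  by (intro submoduleI_smult) auto

text \<open>The definition wants the image of the carrier to be exactly the singleton of zero. An
  empty \<open>L\<close> has empty image, so nonemptiness is what makes pointwise annihilation
  equivalent to it.\<close>

lemma u_S_torsion_iff:
  fixes M :: "('a, 'c, 'm) module_scheme"
  assumes "L \<noteq> {}"
  shows "u_S_torsion S (M\<lparr>carrier := L\<rparr>) \<longleftrightarrow> (\<exists>s\<in>S. \<forall>x\<in>L. s \<odot>\<^bsub>M\<^esub> x = \<zero>\<^bsub>M\<^esub>)"
proof -
  have "f ` L = {z} \<longleftrightarrow> (\<forall>x\<in>L. f x = z)" for f and z :: 'c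
    using assms by auto
  then show ?thesis
    by (simp add: u_S_torsion_def)
qed

lemma (in module) u_S_essential_iff:
  "u_S_essential R S K M \<longleftrightarrow> submodule K R M \<and>
    (\<forall>L. submodule L R M \<longrightarrow> (\<exists>s\<in>S. \<forall>x\<in>K \<inter> L. s \<odot>\<^bsub>M\<^esub> x = \<zero>\<^bsub>M\<^esub>) \<longrightarrow>
      (\<exists>s\<in>S. \<forall>x\<in>L. s \<odot>\<^bsub>M\<^esub> x = \<zero>\<^bsub>M\<^esub>))"
  unfolding u_S_essential_def
\<comment> \<open>\<open>conj_cong\<close> and \<open>all_cong\<close> keep
  \<open>submodule K R M\<close> and \<open>submodule L R M\<close> as assumptions; they make
  \<open>K \<inter> L\<close> and \<open>L\<close> nonempty.\<close>
proof (intro conj_cong refl all_cong imp_cong)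
  fix L
  assume K: "submodule K R M" and L: "submodule L R M"
  show "u_S_torsion S (M\<lparr>carrier := K \<inter> L\<rparr>) \<longleftrightarrow> (\<exists>s\<in>S. \<forall>x\<in>K \<inter> L. s \<odot>\<^bsub>M\<^esub> x = \<zero>\<^bsub>M\<^esub>)"
    by (rule u_S_torsion_iff[OF submoduleE(2)[OF submodule_Int[OF K L]]])
  show "u_S_torsion S (M\<lparr>carrier := L\<rparr>) \<longleftrightarrow> (\<exists>s\<in>S. \<forall>x\<in>L. s \<odot>\<^bsub>M\<^esub> x = \<zero>\<^bsub>M\<^esub>)"
    by (rule u_S_torsion_iff[OF submoduleE(2)[OF L]])
qed

text \<open>Essentiality is used twice: that of \<open>H\<close>, tested on
  \<open>K \<inter> L\<close>, shows that \<open>K \<inter> L\<close> is annihilated by an element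
  of \<open>S\<close>; that of \<open>K\<close>, tested on \<open>L\<close>, then gives the same for
  \<open>L\<close>.\<close>

lemma (in module) u_S_essential_Int:
  assumes H: "u_S_essential R S H M" and K: "u_S_essential R S K M"
  shows "u_S_essential R S (H \<inter> K) M"
  unfolding u_S_essential_iff
proof (intro conjI allI impI)
  show "submodule (H \<inter> K) R M"
    using H K by (simp add: submodule_Int u_S_essential_def)
next
  fix L
  assume L: "submodule L R M"
    and "\<exists>s\<in>S. \<forall>x\<in>(H \<inter> K) \<inter> L. s \<odot>\<^bsub>M\<^esub> x = \<zero>\<^bsub>M\<^esub>"
  then have "\<exists>s\<in>S. \<forall>x\<in>H \<inter> (K \<inter> L). s \<odot>\<^bsub>M\<^esub> x = \<zero>\<^bsub>M\<^esub>"
    by (simp add: Int_assoc)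
  moreover have "submodule (K \<inter> L) R M"
    using K L by (simp add: submodule_Int u_S_essential_def)
  ultimately have "\<exists>s\<in>S. \<forall>x\<in>K \<inter> L. s \<odot>\<^bsub>M\<^esub> x = \<zero>\<^bsub>M\<^esub>"
    using H unfolding u_S_essential_iff by blast
  with K L show "\<exists>s\<in>S. \<forall>x\<in>L. s \<odot>\<^bsub>M\<^esub> x = \<zero>\<^bsub>M\<^esub>"
    unfolding u_S_essential_iff by blast
qed

context module_homomorphism
begin

lemma hom_zero: "f \<zero>\<^bsub>M\<^esub> = \<zero>\<^bsub>N\<^esub>"
proof -
  have "f \<zero>\<^bsub>M\<^esub> = f (\<zero>\<^bsub>R\<^esub> \<odot>\<^bsub>M\<^esub> \<zero>\<^bsub>M\<^esub>)"
    by simp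
  also have "\<dots> = \<zero>\<^bsub>R\<^esub> \<odot>\<^bsub>N\<^esub> f \<zero>\<^bsub>M\<^esub>"
    by (rule hom_smult) simp_all
  also have "\<dots> = \<zero>\<^bsub>N\<^esub>"
    by (simp add: hom_closed)
  finally show ?thesis .
qed

lemma submodule_image:
  assumes "submodule L R M"
  shows "submodule (f ` L) R N"
proof (rule cod.submoduleI_smult)
  note L = dom.submoduleE[OF assms]
  show "f ` L \<subseteq> carrier N"
    using L(1) hom_closed by auto
  show "\<zero>\<^bsub>N\<^esub> \<in> f ` L"
    using dom.submodule_zero[OF assms] hom_zero by (metis imageI)
  show "x \<oplus>\<^bsub>N\<^esub> y \<in> f ` L" if xy: "x \<in> f ` L" "y \<in> f ` L" for x y
  proof -
    obtain u v where "u \<in> L" "v \<in> L" "x = f u" "y = f v"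
      using xy by blast
    with L(1) L(5) hom_add[of u v] show ?thesis
      by (metis imageI subsetD)
  qed
  show "a \<odot>\<^bsub>N\<^esub> x \<in> f ` L" if ax: "a \<in> carrier R" "x \<in> f ` L" for a x
  proof -
    obtain u where "u \<in> L" "x = f u"
      using ax(2) by blast
    with L(1) L(4) ax(1) hom_smult[of a u] show ?thesis
      by (metis imageI subsetD)
  qed
qed

lemma submodule_vimage:
  assumes "submodule K R N"
  shows "submodule {x \<in> carrier M. f x \<in> K} R M"
  using cod.submoduleE[OF assms] cod.submodule_zero[OF assms]
  by (intro dom.submoduleI_smult) (auto simp: hom_zero hom_add hom_smult)

lemma u_S_essential_vimage:
  assumes S: "multiplicative_subset R S" and K: "u_S_essential R S K N"
  shows "u_S_essential R S {x \<in> carrier M. f x \<in> K} M"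
  unfolding dom.u_S_essential_iff
proof (intro conjI allI impI)
  have K_sub: "submodule K R N"
    using K by (simp add: u_S_essential_def)
  then show "submodule {x \<in> carrier M. f x \<in> K} R M"
    by (rule submodule_vimage)
  \<comment> \<open>This supplies that \<open>S\<close> lies in the carrier of \<open>R\<close>, as
    \<open>hom_smult\<close> requires, and that the product of \<open>s\<close> and \<open>t\<close>
    below is again in \<open>S\<close>.\<close>
  interpret S: submonoid S R
    using S by (simp add: multiplicative_subset_def)
  fix L
  assume L: "submodule L R M"
    and "\<exists>s\<in>S. \<forall>x\<in>{x \<in> carrier M. f x \<in> K} \<inter> L. s \<odot>\<^bsub>M\<^esub> x = \<zero>\<^bsub>M\<^esub>"
  then obtain s where s: "s \<in> S"
    and s_zero: "\<And>x. x \<in> carrier M \<Longrightarrow> f x \<in> K \<Longrightarrow> x \<in> L \<Longrightarrow> s \<odot>\<^bsub>M\<^esub> x = \<zero>\<^bsub>M\<^esub>"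
    by blast
  note LE = dom.submoduleE[OF L]
  have "s \<odot>\<^bsub>N\<^esub> y = \<zero>\<^bsub>N\<^esub>" if "y \<in> K \<inter> f ` L" for y
  proof -
    obtain x where x: "x \<in> L" "x \<in> carrier M" "y = f x" "f x \<in> K"
      using \<open>y \<in> K \<inter> f ` L\<close> LE(1) by auto
    then have "s \<odot>\<^bsub>N\<^esub> y = f (s \<odot>\<^bsub>M\<^esub> x)"
      using s by (simp add: hom_smult)
    with x show ?thesis
      by (simp add: s_zero hom_zero)
  qed
  with s have "\<exists>s\<in>S. \<forall>y\<in>K \<inter> f ` L. s \<odot>\<^bsub>N\<^esub> y = \<zero>\<^bsub>N\<^esub>"
    by (intro bexI[of _ s] ballI)
  then have "\<exists>t\<in>S. \<forall>y\<in>f ` L. t \<odot>\<^bsub>N\<^esub> y = \<zero>\<^bsub>N\<^esub>"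
    using K[unfolded cod.u_S_essential_iff, THEN conjunct2, rule_format, OF submodule_image[OF L]]
    by blast
  then obtain t where t: "t \<in> S"
    and t_zero: "\<And>x. x \<in> L \<Longrightarrow> t \<odot>\<^bsub>N\<^esub> f x = \<zero>\<^bsub>N\<^esub>"
    by auto
  \<comment> \<open>The order matters: \<open>s\<close> is only known to annihilate elements of
    \<open>L\<close> that \<open>f\<close> sends into \<open>K\<close>, so \<open>t\<close> acts
    first and makes the image zero.\<close>
  have "(s \<otimes>\<^bsub>R\<^esub> t) \<odot>\<^bsub>M\<^esub> x = \<zero>\<^bsub>M\<^esub>" if x: "x \<in> L" for x
  proof -
    have xM: "x \<in> carrier M"
      using x LE(1) by blast
    have "f (t \<odot>\<^bsub>M\<^esub> x) = \<zero>\<^bsub>N\<^esub>"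
      using t t_zero x xM by (simp add: hom_smult)
    then have "s \<odot>\<^bsub>M\<^esub> (t \<odot>\<^bsub>M\<^esub> x) = \<zero>\<^bsub>M\<^esub>"
      using t x xM LE(4) cod.submodule_zero[OF K_sub] by (intro s_zero) auto
    then show ?thesis
      using s t xM by (simp add: dom.smult_assoc1)
  qed
  with s t show "\<exists>s\<in>S. \<forall>x\<in>L. s \<odot>\<^bsub>M\<^esub> x = \<zero>\<^bsub>M\<^esub>"
    by blast
qed

end

text \<open>Pulling back along the two injections serves the forward implication of the theorem,
  along the two projections the converse.\<close>

lemma module_homomorphism_direct_sum:
  assumes "module R M1" and "module R M2"
  shows "module_homomorphism R M1 (direct_sum M1 M2) (\<lambda>x. (x, \<zero>\<^bsub>M2\<^esub>))"
    and "module_homomorphism R M2 (direct_sum M1 M2) (\<lambda>y. (\<zero>\<^bsub>M1\<^esub>, y))"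
    and "module_homomorphism R (direct_sum M1 M2) M1 fst"
    and "module_homomorphism R (direct_sum M1 M2) M2 snd"
proof -
  interpret M1: module R M1 by fact
  interpret M2: module R M2 by fact
  note sum = direct_sum_module[OF assms]
  show "module_homomorphism R M1 (direct_sum M1 M2) (\<lambda>x. (x, \<zero>\<^bsub>M2\<^esub>))"
    and "module_homomorphism R M2 (direct_sum M1 M2) (\<lambda>y. (\<zero>\<^bsub>M1\<^esub>, y))"
    and "module_homomorphism R (direct_sum M1 M2) M1 fst"
    and "module_homomorphism R (direct_sum M1 M2) M2 snd"
    by (intro module_homomorphism.intro module_homomorphism_axioms.intro assms sum;
        auto simp: direct_sum_def)+
qed

theorem theorem2p21:
  fixes R :: "('a, 'r) ring_scheme"
    and S :: "'a set"
    and M1 :: "('a, 'b, 'm) module_scheme"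
    and M2 :: "('a, 'c, 'n) module_scheme"
    and K1 :: "'b set"
    and K2 :: "'c set"
  assumes "cring R"
    and "\<one>\<^bsub>R\<^esub> \<noteq> \<zero>\<^bsub>R\<^esub>"
    and "multiplicative_subset R S"
    and "module R M1"
    and "module R M2"
    and "submodule K1 R M1"
    and "submodule K2 R M2"
  shows "u_S_essential R S (K1 \<times> K2) (direct_sum M1 M2) \<longleftrightarrow>
    u_S_essential R S K1 M1 \<and> u_S_essential R S K2 M2"
proof -
  note hom = module_homomorphism_direct_sum[OF assms(4,5)]
  note vimage = hom[THEN module_homomorphism.u_S_essential_vimage, OF assms(3)]
  note K1 = module.submoduleE(1)[OF assms(4,6)] module.submodule_zero[OF assms(4,6)]
  note K2 = module.submoduleE(1)[OF assms(5,7)] module.submodule_zero[OF assms(5,7)]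
  \<comment> \<open>The padding zero of each injection lies in the other submodule, so it imposes no
    condition.\<close>
  have K1_eq: "{x \<in> carrier M1. (x, \<zero>\<^bsub>M2\<^esub>) \<in> K1 \<times> K2} = K1"
    and K2_eq: "{y \<in> carrier M2. (\<zero>\<^bsub>M1\<^esub>, y) \<in> K1 \<times> K2} = K2"
    using K1 K2 by auto
  \<comment> \<open>The two preimages are \<open>K1 \<times> carrier M2\<close> and
    \<open>carrier M1 \<times> K2\<close>; they meet in \<open>K1 \<times> K2\<close> because each
    submodule lies in its carrier.\<close>
  have prod_eq: "{z \<in> carrier (direct_sum M1 M2). fst z \<in> K1} \<inter>
      {z \<in> carrier (direct_sum M1 M2). snd z \<in> K2} = K1 \<times> K2"
    using K1 K2 by (auto simp: direct_sum_def)
  show ?thesis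
  proof
    assume "u_S_essential R S (K1 \<times> K2) (direct_sum M1 M2)"
    from vimage(1,2)[OF this] show "u_S_essential R S K1 M1 \<and> u_S_essential R S K2 M2"
      unfolding K1_eq K2_eq ..
  next
    assume "u_S_essential R S K1 M1 \<and> u_S_essential R S K2 M2"
    then show "u_S_essential R S (K1 \<times> K2) (direct_sum M1 M2)"
      using module.u_S_essential_Int[OF direct_sum_module[OF assms(4,5)] vimage(3,4), of K1 K2]
      unfolding prod_eq by blast
  qed
qed

end
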